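(* Let $v:R\to\mathbb G\cup\{\infty\}$ be a valuation on a superring $R$. Then: (i) There is a one-to-one order-reversing correspondence (with respect to inclusion) between the set of $v$-convex superideals of $A_v$ not contained in $\mathrm{supp}(v)$ and the set of proper segments of $\mathbb G$. (ii) The $v$-convex prime superideals of $A_v$ not contained in $\mathrm{supp}(v)$ are in one-to-one order-reversing correspondence with the proper isolated subgroups of $\mathbb G$. (iii) The $v$-convex prime ideals of $A_v$ are exactly those prime ideals $\mathfrak a$ of $A_v$ with $\mathrm{supp}(v)\subseteq\mathfrak a\subseteq\mathfrak p_v$.
   Context: A superring is a $\mathbb Z/2$-graded unital ring $R=R_{\overline 0}\oplus R_{\overline 1}$ with $1\neq 0$, assumed supercommutative: $R_{\overline 0}$ is central in $R$ and every element of $R_{\overline 1}$ squares to zero. A superideal is a graded ideal. An ideal $\mathfrak p$ of a superring $A$ is prime if $A/\mathfrak p$ is an integral domain. A valuation on $R$ is a surjective map $v:R\to\mathbb G\cup\{\infty\}$, where $(\mathbb G,+,0)$ is a totally ordered abelian group (order invariant under translation) and $\infty$ is a symbol with $\infty>\alpha$ for $\alpha\in\mathbb G$ and $\infty+\alpha=\alpha+\infty=\infty+\infty=\infty$, such that $v(0)=\infty$, $v(1)=0$, $v(xy)=v(x)+v(y)$ and $v(x+y)\ge\min\{v(x),v(y)\}$ for all $x,y\in R$. Put $A_v=\{x\in R\mid v(x)\ge 0\}$ (a subsuperring of $R$), $\mathfrak p_v=\{x\in R\mid v(x)>0\}$ and $\mathrm{supp}(v)=v^{-1}(\infty)$. A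 $v$-convex ideal $\mathfrak a$ of $A_v$ is an ideal such that $x\in\mathfrak a$ and $v(y)\ge v(x)$ imply $y\in\mathfrak a$. A subset $\mathbb H\subseteq\mathbb G$ is a segment if whenever $x\in\mathbb H$, every $y\in\mathbb G$ lying between $x$ and $-x$ (inclusive, i.e. $-|x|\le y\le |x|$ with $|x|=\max\{x,-x\}$) belongs to $\mathbb H$; the empty set is a segment. A segment is proper if it is different from $\mathbb G$. An isolated subgroup of $\mathbb G$ is a proper subgroup of $\mathbb G$ which is also a segment. Segments and isolated subgroups are ordered by inclusion. *)

theory Defs
  imports "HOL-Algebra.QuotRing"
begin

section \<open>Superrings, superideals and prime ideals\<close>

text \<open>The grading is given by the two carriers \<open>R0\<close> (even) and \<open>R1\<close> (odd). That \<open>\<one>\<close> is even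
  is a consequence of the axioms.\<close>

locale superring = ring R for R (structure) +
  fixes R0 R1 :: "'a set"
  assumes even_subgroup: "additive_subgroup R0 R"
    and odd_subgroup: "additive_subgroup R1 R"
    and even_plus_odd: "R0 <+>\<^bsub>R\<^esub> R1 = carrier R"
    and even_inter_odd: "R0 \<inter> R1 = {\<zero>}"
    and even_even: "\<lbrakk>x \<in> R0; y \<in> R0\<rbrakk> \<Longrightarrow> x \<otimes> y \<in> R0"
    and even_odd: "\<lbrakk>x \<in> R0; y \<in> R1\<rbrakk> \<Longrightarrow> x \<otimes> y \<in> R1"
    and odd_even: "\<lbrakk>x \<in> R1; y \<in> R0\<rbrakk> \<Longrightarrow> x \<otimes> y \<in> R1"
    and odd_odd: "\<lbrakk>x \<in> R1; y \<in> R1\<rbrakk> \<Longrightarrow> x \<otimes> y \<in> R0"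
    and one_neq_zero: "\<one> \<noteq> \<zero>"
    and even_central: "\<lbrakk>x \<in> R0; y \<in> carrier R\<rbrakk> \<Longrightarrow> x \<otimes> y = y \<otimes> x"
    and odd_square_zero: "x \<in> R1 \<Longrightarrow> x \<otimes> x = \<zero>"

definition superideal :: "'a set \<Rightarrow> ('a, 'm) ring_scheme \<Rightarrow> 'a set \<Rightarrow> 'a set \<Rightarrow> bool" where
  "superideal I A A0 A1 \<longleftrightarrow> ideal I A \<and> (I \<inter> A0) <+>\<^bsub>A\<^esub> (I \<inter> A1) = I"

text \<open>The library's \<open>primeideal\<close> presupposes a commutative ring, which a superring need not be;
  \<open>domain\<close> includes commutativity of the quotient and \<open>\<one> \<noteq> \<zero>\<close> in it.\<close>

definition prime_ideal :: "'a set \<Rightarrow> ('a, 'm) ring_scheme \<Rightarrow> bool" where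
  "prime_ideal I A \<longleftrightarrow> ideal I A \<and> domain (A Quot I)"


section \<open>Ordered abelian groups with infinity\<close>

datatype 'g with_infty = Fin 'g | Infty

instantiation with_infty :: (linorder) linorder
begin

fun less_eq_with_infty :: "'a with_infty \<Rightarrow> 'a with_infty \<Rightarrow> bool" where
  "x \<le> Infty \<longleftrightarrow> True"
| "Fin a \<le> Fin b \<longleftrightarrow> a \<le> b"
| "Infty \<le> Fin b \<longleftrightarrow> False"

definition less_with_infty :: "'a with_infty \<Rightarrow> 'a with_infty \<Rightarrow> bool" where
  "(x :: 'a with_infty) < y \<longleftrightarrow> x \<le> y \<and> \<not> y \<le> x"

instance
proof
  fix x y z :: "'a with_infty"
  show "x < y \<longleftrightarrow> x \<le> y \<and> \<not> y \<le> x" by (rule less_with_infty_def)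
  show "x \<le> x" by (cases x) auto
  show "x \<le> y \<Longrightarrow> y \<le> z \<Longrightarrow> x \<le> z" by (cases x; cases y; cases z) auto
  show "x \<le> y \<Longrightarrow> y \<le> x \<Longrightarrow> x = y" by (cases x; cases y) auto
  show "x \<le> y \<or> y \<le> x" by (cases x; cases y) auto
qed

end

instantiation with_infty :: (comm_monoid_add) comm_monoid_add
begin

definition zero_with_infty :: "'a with_infty" where
  "(0 :: 'a with_infty) = Fin 0"

fun plus_with_infty :: "'a with_infty \<Rightarrow> 'a with_infty \<Rightarrow> 'a with_infty" where
  "Fin a + Fin b = Fin (a + b)"
| "Infty + y = Infty"
| "x + Infty = Infty"

instance
proof
  fix x y z :: "'a with_infty"
  show "x + y + z = x + (y + z)" by (cases x; cases y; cases z) (auto simp: add.assoc)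
  show "x + y = y + x" by (cases x; cases y) (auto simp: add.commute)
  show "0 + x = x" by (cases x) (auto simp: zero_with_infty_def)
qed

end


section \<open>Valuations\<close>

locale valuation = ring R for R (structure) +
  fixes v :: "'a \<Rightarrow> 'g::linordered_ab_group_add with_infty"
  assumes surj: "v ` carrier R = UNIV"
    and val_zero: "v \<zero> = Infty"
    and val_one: "v \<one> = 0"
    and val_mult: "\<lbrakk>x \<in> carrier R; y \<in> carrier R\<rbrakk> \<Longrightarrow> v (x \<otimes> y) = v x + v y"
    and val_add: "\<lbrakk>x \<in> carrier R; y \<in> carrier R\<rbrakk> \<Longrightarrow> min (v x) (v y) \<le> v (x \<oplus> y)"

definition val_ring ::
    "('a, 'm) ring_scheme \<Rightarrow> ('a \<Rightarrow> 'g::linordered_ab_group_add with_infty) \<Rightarrow> ('a, 'm) ring_scheme"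
  where "val_ring R v = R\<lparr>carrier := {x \<in> carrier R. 0 \<le> v x}\<rparr>"

definition val_ideal ::
    "('a, 'm) ring_scheme \<Rightarrow> ('a \<Rightarrow> 'g::linordered_ab_group_add with_infty) \<Rightarrow> 'a set"
  where "val_ideal R v = {x \<in> carrier R. 0 < v x}"

definition val_supp ::
    "('a, 'm) ring_scheme \<Rightarrow> ('a \<Rightarrow> 'g::linordered_ab_group_add with_infty) \<Rightarrow> 'a set"
  where "val_supp R v = {x \<in> carrier R. v x = Infty}"

definition v_convex ::
    "('a, 'm) ring_scheme \<Rightarrow> ('a \<Rightarrow> 'g::linordered_ab_group_add with_infty) \<Rightarrow> 'a set \<Rightarrow> bool"
  where "v_convex R v I \<longleftrightarrow>
    ideal I (val_ring R v) \<and> (\<forall>x \<in> I. \<forall>y \<in> carrier R. v x \<le> v y \<longrightarrow> y \<in> I)"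

text \<open>The valuation ring carries the grading induced from \<open>R\<close>.\<close>

definition val_superideal ::
    "('a, 'm) ring_scheme \<Rightarrow> 'a set \<Rightarrow> 'a set \<Rightarrow>
      ('a \<Rightarrow> 'g::linordered_ab_group_add with_infty) \<Rightarrow> 'a set \<Rightarrow> bool"
  where "val_superideal R R0 R1 v I \<longleftrightarrow>
    superideal I (val_ring R v)
      (carrier (val_ring R v) \<inter> R0) (carrier (val_ring R v) \<inter> R1)"


section \<open>Segments and isolated subgroups\<close>

text \<open>\<open>max x (- x)\<close> is the absolute value, for which the type class has no operation.\<close>

definition segment :: "'g::linordered_ab_group_add set \<Rightarrow> bool" where
  "segment H \<longleftrightarrow> (\<forall>x \<in> H. \<forall>y. - max x (- x) \<le> y \<and> y \<le> max x (- x) \<longrightarrow> y \<in> H)"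

definition proper_segment :: "'g::linordered_ab_group_add set \<Rightarrow> bool" where
  "proper_segment H \<longleftrightarrow> segment H \<and> H \<noteq> UNIV"

definition isolated_subgroup :: "'g::linordered_ab_group_add set \<Rightarrow> bool" where
  "isolated_subgroup H \<longleftrightarrow>
    0 \<in> H \<and> (\<forall>x \<in> H. \<forall>y \<in> H. x + y \<in> H) \<and> (\<forall>x \<in> H. - x \<in> H) \<and> H \<noteq> UNIV \<and> segment H"


section \<open>Order-reversing correspondences\<close>

definition order_reversing_bij :: "('a set \<Rightarrow> 'b set) \<Rightarrow> 'a set set \<Rightarrow> 'b set set \<Rightarrow> bool" where
  "order_reversing_bij f \<A> \<B> \<longleftrightarrow>
    bij_betw f \<A> \<B> \<and> (\<forall>X \<in> \<A>. \<forall>Y \<in> \<A>. X \<subseteq> Y \<longleftrightarrow> f Y \<subseteq> f X)"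

end

theory Submission
  imports Defs "HOL-Algebra.Subrings"
begin

text \<open>
  An odd element \<open>x\<close> satisfies \<open>x\<^sup>2 = 0\<close>, hence \<open>v x + v x = \<infinity>\<close> and \<open>v x = \<infinity>\<close>: the valuation only
  sees even parts. Two things follow. A \<open>v\<close>-convex ideal, which always contains the support, is
  automatically graded, because passing from an element to its even part cannot decrease the value.
  Commutators lie in the support, since only the product of the two odd parts contributes to
  them; so the quotient by an ideal containing the support is commutative, and primality becomes
  the usual elementwise condition.

  A \<open>v\<close>-convex ideal is then determined by the values of its elements, an upper set in the
  non-negative part of the value group together with \<open>\<infinity>\<close>. The complementary lower set of non-negative
  values, made symmetric under negation, is the corresponding segment; it is proper exactly when the
  ideal has an element of finite value (\<open>segments_correspondence\<close>). As every group
  element is a value, the condition that \<open>x \<notin> I\<close> and \<open>y \<notin> I\<close> imply \<open>x y \<notin> I\<close> says exactly that the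
  segment is closed under addition of non-negative elements, and \<open>1 \<notin> I\<close> says that it contains \<open>0\<close>;
  this restricts the correspondence to prime ideals and isolated subgroups (\<open>prime_iff_isolated\<close>).

  For a prime ideal between the support and \<open>p\<^sub>v\<close>, convexity is a division argument: if
  \<open>x\<close> is in the ideal, \<open>v y \<ge> v x\<close> and \<open>v z = - v x\<close>, then \<open>z x\<close> has value \<open>0\<close>, so is outside the ideal,
  whereas \<open>(z x) y\<close> agrees modulo the support with \<open>(z y) x\<close>, which is in the ideal
  (\<open>convex_if_between\<close>).
\<close>


section \<open>Order-reversing bijections\<close>

lemma order_reversing_bijI:
  assumes f: "\<And>X. X \<in> \<A> \<Longrightarrow> f X \<in> \<B>" and g: "\<And>Y. Y \<in> \<B> \<Longrightarrow> g Y \<in> \<A>"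
    and gf: "\<And>X. X \<in> \<A> \<Longrightarrow> g (f X) = X" and fg: "\<And>Y. Y \<in> \<B> \<Longrightarrow> f (g Y) = Y"
    and anti_f: "antimono f" and anti_g: "antimono g"
  shows "order_reversing_bij f \<A> \<B>"
  unfolding order_reversing_bij_def
proof (intro conjI ballI iffI)
  show "bij_betw f \<A> \<B>"
    by (rule bij_betw_byWitness[of _ g]) (use f g gf fg in auto)
next
  fix X Y assume "X \<in> \<A>" "Y \<in> \<A>" "X \<subseteq> Y"
  then show "f Y \<subseteq> f X" using anti_f by (simp add: antimonoD)
next
  fix X Y assume "X \<in> \<A>" "Y \<in> \<A>" "f Y \<subseteq> f X"
  then show "X \<subseteq> Y" using anti_g gf by (metis antimonoD)
qed

lemma order_reversing_bij_restrict:
  assumes f: "order_reversing_bij f \<A> \<B>" and "\<A>' \<subseteq> \<A>" and "\<B>' \<subseteq> \<B>"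
    and iff: "\<And>X. X \<in> \<A> \<Longrightarrow> X \<in> \<A>' \<longleftrightarrow> f X \<in> \<B>'"
  shows "order_reversing_bij f \<A>' \<B>'"
proof -
  have bij: "bij_betw f \<A> \<B>" using f by (simp add: order_reversing_bij_def)
  have "f ` \<A>' = \<B>'"
  proof
    show "f ` \<A>' \<subseteq> \<B>'" using iff \<open>\<A>' \<subseteq> \<A>\<close> by auto
    show "\<B>' \<subseteq> f ` \<A>'"
    proof
      fix Y assume "Y \<in> \<B>'"
      then obtain X where "X \<in> \<A>" "Y = f X"
        using \<open>\<B>' \<subseteq> \<B>\<close> bij by (auto simp: bij_betw_def)
      with iff \<open>Y \<in> \<B>'\<close> show "Y \<in> f ` \<A>'" by auto
    qed
  qed
  with bij \<open>\<A>' \<subseteq> \<A>\<close> have "bij_betw f \<A>' \<B>'" by (rule bij_betw_subset)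
  with f \<open>\<A>' \<subseteq> \<A>\<close> show ?thesis unfolding order_reversing_bij_def by blast
qed


section \<open>Totally ordered groups and infinity\<close>

lemma max_neg_nonneg: "0 \<le> max g (- g)" for g :: "'g::linordered_ab_group_add"
  by (metis le_max_iff_disj linear neg_0_le_iff_le)

lemma max_neg_of_nonneg: "0 \<le> g \<Longrightarrow> max g (- g) = g" for g :: "'g::linordered_ab_group_add"
  by (metis max.absorb1 neg_le_0_iff_le order_trans)

lemma max_neg_triangle:
  "max (g + h) (- (g + h)) \<le> max g (- g) + max h (- h)" for g :: "'g::linordered_ab_group_add"
proof (rule max.boundedI)
  show "g + h \<le> max g (- g) + max h (- h)" by (intro add_mono) auto
  have "- g + - h \<le> max g (- g) + max h (- h)" by (intro add_mono) auto
  then show "- (g + h) \<le> max g (- g) + max h (- h)" by (simp add: add.commute)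
qed

lemma segmentD:
  assumes "segment H" and "x \<in> H" and "max y (- y) \<le> max x (- x)"
  shows "y \<in> H"
proof -
  have "y \<le> max x (- x)" and "- y \<le> max x (- x)"
    using assms(3) by (simp_all only: max.bounded_iff)
  then have "- max x (- x) \<le> y" by (metis neg_le_iff_le minus_minus)
  with \<open>y \<le> max x (- x)\<close> assms show ?thesis unfolding segment_def by blast
qed

lemma proper_segment_imp_segment: "proper_segment H \<Longrightarrow> segment H"
  by (simp add: proper_segment_def)

lemma Fin_less_iff [simp]: "Fin a < Fin b \<longleftrightarrow> a < b"
  by (auto simp: less_with_infty_def)

lemma Fin_less_Infty [simp]: "Fin a < Infty"
  by (simp add: less_with_infty_def)

lemma with_infty_add_eq_Infty_iff [simp]:
  "a + b = Infty \<longleftrightarrow> a = Infty \<or> b = Infty" for a b :: "'g::comm_monoid_add with_infty"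
  by (cases a; cases b) auto

lemma with_infty_le_add:
  "0 \<le> b \<Longrightarrow> a \<le> b + a" for a b :: "'g::linordered_ab_group_add with_infty"
  by (cases a; cases b) (auto simp: zero_with_infty_def)

lemma Infty_le_iff [simp]: "Infty \<le> a \<longleftrightarrow> a = Infty" for a :: "'g::linorder with_infty"
  by (cases a) auto


section \<open>Elementwise primality\<close>

context ideal
begin

lemma rcos_eq_iff:
  assumes "x \<in> carrier R" and "y \<in> carrier R"
  shows "I +> x = I +> y \<longleftrightarrow> x \<ominus> y \<in> I"
  using assms by (rule quotient_eq_iff_same_a_r_cos[OF ideal_axioms, symmetric])

text \<open>Over a ring that need not be commutative, being a domain requires the quotient to be
  commutative, hence the condition on commutators.\<close>

lemma prime_ideal_iff:
  "prime_ideal I R \<longleftrightarrow> \<one> \<notin> I \<and>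
     (\<forall>x \<in> carrier R. \<forall>y \<in> carrier R. x \<otimes> y \<in> I \<longrightarrow> x \<in> I \<or> y \<in> I) \<and>
     (\<forall>x \<in> carrier R. \<forall>y \<in> carrier R. x \<otimes> y \<ominus> y \<otimes> x \<in> I)" (is "_ \<longleftrightarrow> ?rhs")
proof -
  have carrier: "carrier (R Quot I) = (\<lambda>x. I +> x) ` carrier R"
    by (auto simp: FactRing_def A_RCOSETS_def')
  have mult: "(I +> x) \<otimes>\<^bsub>R Quot I\<^esub> (I +> y) = I +> (x \<otimes> y)"
    if "x \<in> carrier R" "y \<in> carrier R" for x y
    using that by (simp add: FactRing_def rcoset_mult_add)
  have one: "\<one>\<^bsub>R Quot I\<^esub> = I +> \<one>" by (simp add: FactRing_def)
  have zero: "\<zero>\<^bsub>R Quot I\<^esub> = I" by (simp add: FactRing_def)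
  have coset: "I +> x = I \<longleftrightarrow> x \<in> I" if "x \<in> carrier R" for x
    using that a_rcos_const a_rcos_self by blast
  show ?thesis
  proof
    assume "prime_ideal I R"
    then interpret Q: domain "R Quot I" by (simp add: prime_ideal_def)
    show ?rhs
    proof (intro conjI ballI impI)
      show "\<one> \<notin> I" using Q.one_not_zero coset by (simp add: one zero)
    next
      fix x y assume x: "x \<in> carrier R" and y: "y \<in> carrier R" and "x \<otimes> y \<in> I"
      then have "(I +> x) \<otimes>\<^bsub>R Quot I\<^esub> (I +> y) = \<zero>\<^bsub>R Quot I\<^esub>"
        by (simp add: mult zero coset)
      then have "I +> x = I \<or> I +> y = I"
        using Q.integral[of "I +> x" "I +> y"] x y by (simp add: carrier zero)
      then show "x \<in> I \<or> y \<in> I" using x y by (simp add: coset)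
    next
      fix x y assume x: "x \<in> carrier R" and y: "y \<in> carrier R"
      then have "(I +> x) \<otimes>\<^bsub>R Quot I\<^esub> (I +> y) = (I +> y) \<otimes>\<^bsub>R Quot I\<^esub> (I +> x)"
        by (intro Q.m_comm) (simp_all add: carrier)
      with x y show "x \<otimes> y \<ominus> y \<otimes> x \<in> I" by (simp add: mult rcos_eq_iff)
    qed
  next
    assume rhs: ?rhs
    interpret Q: ring "R Quot I" by (rule quotient_is_ring)
    have "comm_monoid (R Quot I)"
    proof (rule Q.monoid_comm_monoidI)
      fix X Y assume "X \<in> carrier (R Quot I)" and "Y \<in> carrier (R Quot I)"
      then obtain x y where "x \<in> carrier R" "X = I +> x" and "y \<in> carrier R" "Y = I +> y"
        unfolding carrier by blast
      with rhs show "X \<otimes>\<^bsub>R Quot I\<^esub> Y = Y \<otimes>\<^bsub>R Quot I\<^esub> X"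
        by (simp add: mult rcos_eq_iff)
    qed
    then have "cring (R Quot I)" by (intro cring.intro Q.ring_axioms)
    moreover have "domain_axioms (R Quot I)"
    proof (rule domain_axioms.intro)
      show "\<one>\<^bsub>R Quot I\<^esub> \<noteq> \<zero>\<^bsub>R Quot I\<^esub>" using rhs by (simp add: one zero coset)
    next
      fix X Y
      assume XY: "X \<otimes>\<^bsub>R Quot I\<^esub> Y = \<zero>\<^bsub>R Quot I\<^esub>"
        and "X \<in> carrier (R Quot I)" and "Y \<in> carrier (R Quot I)"
      then obtain x y where x: "x \<in> carrier R" "X = I +> x" and y: "y \<in> carrier R" "Y = I +> y"
        unfolding carrier by blast
      with XY have "x \<otimes> y \<in> I" by (simp add: mult zero coset)
      with rhs x y show "X = \<zero>\<^bsub>R Quot I\<^esub> \<or> Y = \<zero>\<^bsub>R Quot I\<^esub>" by (simp add: zero coset)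
    qed
    ultimately have "domain (R Quot I)" by (rule domain.intro)
    then show "prime_ideal I R" by (simp add: prime_ideal_def ideal_axioms)
  qed
qed

end


section \<open>Valuations on rings\<close>

context valuation
begin

lemma val_minus_one: "v (\<ominus> \<one>) = 0"
proof -
  have eq: "v (\<ominus> \<one>) + v (\<ominus> \<one>) = 0"
    using val_mult[of "\<ominus> \<one>" "\<ominus> \<one>"] by (simp add: l_minus val_one)
  then obtain a where a: "v (\<ominus> \<one>) = Fin a"
    by (cases "v (\<ominus> \<one>)") (auto simp: zero_with_infty_def)
  with eq have "a + a = 0" by (simp add: zero_with_infty_def)
  with a show ?thesis by (simp add: zero_with_infty_def)
qed

lemma val_uminus: "x \<in> carrier R \<Longrightarrow> v (\<ominus> x) = v x"
  using val_mult[of "\<ominus> \<one>" x] by (simp add: l_minus val_minus_one)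

lemma val_diff:
  assumes "x \<in> carrier R" and "y \<in> carrier R"
  shows "min (v x) (v y) \<le> v (x \<ominus> y)"
  using val_add[of x "\<ominus> y"] assms by (simp add: a_minus_def val_uminus)

lemma val_onto: obtains x where "x \<in> carrier R" and "v x = g"
  using surj by (metis UNIV_I imageE)

lemma val_ring_simps [simp]:
  "mult (val_ring R v) = mult R" "add (val_ring R v) = add R"
  "one (val_ring R v) = \<one>" "zero (val_ring R v) = \<zero>"
  by (simp_all add: val_ring_def)

lemma carrier_val_ring [simp]: "carrier (val_ring R v) = {x \<in> carrier R. 0 \<le> v x}"
  by (simp add: val_ring_def)

lemma subring_val_ring: "subring {x \<in> carrier R. 0 \<le> v x} R"
proof (rule subringI)
  fix x y assume "x \<in> {x \<in> carrier R. 0 \<le> v x}" and "y \<in> {x \<in> carrier R. 0 \<le> v x}"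
  then have x: "x \<in> carrier R" "0 \<le> v x" and y: "y \<in> carrier R" "0 \<le> v y" by auto
  have "0 \<le> v x + v y" using x(2) y(2) with_infty_le_add[of "v x" "v y"] by simp
  then show "x \<otimes> y \<in> {x \<in> carrier R. 0 \<le> v x}" using x y by (simp add: val_mult)
  have "0 \<le> v (x \<oplus> y)" using x y val_add[of x y] by (meson min.boundedI order_trans)
  then show "x \<oplus> y \<in> {x \<in> carrier R. 0 \<le> v x}" using x y by simp
qed (auto simp: val_one val_uminus)

lemma ring_val_ring: "ring (val_ring R v)"
  unfolding val_ring_def by (rule subring_is_ring[OF subring_val_ring])

lemma minus_val_ring:
  assumes "x \<in> carrier R" "0 \<le> v x"
  shows "\<ominus>\<^bsub>val_ring R v\<^esub> x = \<ominus> x"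
proof -
  interpret A: ring "val_ring R v" by (rule ring_val_ring)
  show ?thesis
    using A.minus_equality[of "\<ominus> x" x] assms by (simp add: val_uminus l_neg)
qed

lemma v_convex_in_val_ring: "v_convex R v I \<Longrightarrow> x \<in> I \<Longrightarrow> x \<in> carrier R \<and> 0 \<le> v x"
  unfolding v_convex_def
  by (metis (no_types, lifting) carrier_val_ring ideal.Icarr mem_Collect_eq)

lemma v_convexD:
  "v_convex R v I \<Longrightarrow> x \<in> I \<Longrightarrow> y \<in> carrier R \<Longrightarrow> v x \<le> v y \<Longrightarrow> y \<in> I"
  unfolding v_convex_def by blast

lemma ideal_zero_mem: "ideal I (val_ring R v) \<Longrightarrow> \<zero> \<in> I"
  using additive_subgroup.zero_closed[OF ideal.axioms(1)] by fastforce

lemma supp_subset_v_convex: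
  assumes "v_convex R v I" shows "val_supp R v \<subseteq> I"
proof -
  have "\<zero> \<in> I" using assms ideal_zero_mem by (simp add: v_convex_def)
  then show ?thesis using v_convexD[OF assms] by (auto simp: val_supp_def val_zero)
qed


section \<open>Convex ideals and segments\<close>

text \<open>For a convex ideal these are the \<open>g\<close> for which \<open>\<bar>g\<bar>\<close> is not the value of an element
  of the ideal; bounding \<open>\<bar>g\<bar>\<close> by all values instead makes the construction antitone on
  arbitrary sets.\<close>

definition ideal_segment :: "'a set \<Rightarrow> 'g set" where
  "ideal_segment I = {g. \<forall>x \<in> I. Fin (max g (- g)) < v x}"

text \<open>The condition \<open>0 \<le> v x\<close> makes the empty segment correspond to \<open>A\<^sub>v\<close>.\<close>

definition segment_ideal :: "'g set \<Rightarrow> 'a set" where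
  "segment_ideal H = {x \<in> carrier R. 0 \<le> v x \<and> (\<forall>h \<in> H. Fin h < v x)}"

lemma antimono_ideal_segment: "antimono ideal_segment"
  by (rule antimonoI) (auto simp: ideal_segment_def)

lemma antimono_segment_ideal: "antimono segment_ideal"
  by (rule antimonoI) (auto simp: segment_ideal_def)

text \<open>By convexity, membership in the ideal depends on the value only; this turns statements about
  elements of the ideal into statements about group elements and back.\<close>

lemma mem_ideal_segment_iff:
  assumes I: "v_convex R v I" and x: "x \<in> carrier R" and a: "v x = Fin a" "0 \<le> a"
  shows "a \<in> ideal_segment I \<longleftrightarrow> x \<notin> I"
proof
  assume "a \<in> ideal_segment I"
  then show "x \<notin> I" using a by (auto simp: ideal_segment_def max_neg_of_nonneg)
next
  assume "x \<notin> I"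
  then have "Fin a < v y" if "y \<in> I" for y
    using v_convexD[OF I that x] a by (metis not_le)
  with a show "a \<in> ideal_segment I" by (simp add: ideal_segment_def max_neg_of_nonneg)
qed

lemma ideal_segment_max_neg: "max g (- g) \<in> ideal_segment I \<longleftrightarrow> g \<in> ideal_segment I"
  by (simp add: ideal_segment_def max_neg_of_nonneg[OF max_neg_nonneg])

lemma segment_ideal_segment: "segment (ideal_segment I)"
  unfolding segment_def
proof (intro ballI allI impI)
  fix x y assume x: "x \<in> ideal_segment I" and "- max x (- x) \<le> y \<and> y \<le> max x (- x)"
  then have "max y (- y) \<le> max x (- x)"
    by (metis max.boundedI minus_le_iff)
  then have "Fin (max y (- y)) \<le> Fin (max x (- x))" by simp
  with x show "y \<in> ideal_segment I"
    unfolding ideal_segment_def mem_Collect_eq by (blast intro: le_less_trans)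
qed

lemma proper_ideal_segment:
  assumes I: "v_convex R v I" and "\<not> I \<subseteq> val_supp R v"
  shows "proper_segment (ideal_segment I)"
proof -
  obtain x where x: "x \<in> I" "v x \<noteq> Infty"
    using assms v_convex_in_val_ring by (auto simp: val_supp_def)
  then obtain a where a: "v x = Fin a" by (cases "v x") auto
  with x I have "a \<notin> ideal_segment I"
    using mem_ideal_segment_iff[OF I, of x a] v_convex_in_val_ring[OF I, of x]
    by (simp add: zero_with_infty_def)
  then show ?thesis using segment_ideal_segment by (auto simp: proper_segment_def)
qed

lemma segment_ideal_upward:
  assumes x: "x \<in> segment_ideal H" and y: "y \<in> carrier R" and le: "v x \<le> v y"
  shows "y \<in> segment_ideal H"
proof -
  have "0 \<le> v y" using x le by (force simp: segment_ideal_def)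
  moreover have "Fin h < v y" if "h \<in> H" for h
    using x that less_le_trans[OF _ le] by (simp add: segment_ideal_def)
  ultimately show ?thesis using y by (simp add: segment_ideal_def)
qed

lemma v_convex_segment_ideal: "v_convex R v (segment_ideal H)"
  unfolding v_convex_def
proof
  interpret A: ring "val_ring R v" by (rule ring_val_ring)
  show "ideal (segment_ideal H) (val_ring R v)"
  proof (rule idealI[OF ring_val_ring])
    show "subgroup (segment_ideal H) (add_monoid (val_ring R v))"
    proof (rule A.add.subgroupI)
      show "segment_ideal H \<subseteq> carrier (val_ring R v)" by (auto simp: segment_ideal_def)
      have "\<zero> \<in> segment_ideal H" by (simp add: segment_ideal_def val_zero)
      then show "segment_ideal H \<noteq> {}" by blast
    next
      fix x assume "x \<in> segment_ideal H"
      then show "\<ominus>\<^bsub>val_ring R v\<^esub> x \<in> segment_ideal H"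
        by (auto simp: segment_ideal_def minus_val_ring val_uminus)
    next
      fix x y assume xy: "x \<in> segment_ideal H" "y \<in> segment_ideal H"
      then have c: "x \<in> carrier R" "y \<in> carrier R" by (auto simp: segment_ideal_def)
      then have "v x \<le> v (x \<oplus> y) \<or> v y \<le> v (x \<oplus> y)"
        using val_add[of x y] by (simp add: min_le_iff_disj)
      with xy c have "x \<oplus> y \<in> segment_ideal H" by (blast intro: segment_ideal_upward)
      then show "x \<oplus>\<^bsub>val_ring R v\<^esub> y \<in> segment_ideal H" by simp
    qed
  next
    fix a x assume a: "a \<in> segment_ideal H" and "x \<in> carrier (val_ring R v)"
    then have c: "a \<in> carrier R" "x \<in> carrier R" "0 \<le> v x" by (auto simp: segment_ideal_def)
    then have "v a \<le> v (x \<otimes> a)" and "v a \<le> v (a \<otimes> x)"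
      using with_infty_le_add[of "v x" "v a"] by (simp_all add: val_mult add.commute[of "v a"])
    then show "x \<otimes>\<^bsub>val_ring R v\<^esub> a \<in> segment_ideal H"
      and "a \<otimes>\<^bsub>val_ring R v\<^esub> x \<in> segment_ideal H"
      using segment_ideal_upward[OF a] c by simp_all
  qed
qed (blast intro: segment_ideal_upward)

text \<open>A proper segment omits some \<open>g\<close>, and then lies strictly below \<open>\<bar>g\<bar>\<close>; an element of value \<open>\<bar>g\<bar>\<close>
  exists because \<open>v\<close> is surjective.\<close>

lemma segment_ideal_not_subset_supp:
  assumes H: "proper_segment H"
  shows "\<not> segment_ideal H \<subseteq> val_supp R v"
proof -
  obtain g where "g \<notin> H" using H by (auto simp: proper_segment_def)
  obtain x where x: "x \<in> carrier R" "v x = Fin (max g (- g))" by (rule val_onto)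
  have "h < max g (- g)" if "h \<in> H" for h
  proof (rule ccontr)
    assume "\<not> h < max g (- g)"
    then have "max g (- g) \<le> max h (- h)" by (meson max.coboundedI1 not_le)
    with that \<open>g \<notin> H\<close> H show False by (metis proper_segment_def segmentD)
  qed
  with x have "x \<in> segment_ideal H"
    by (simp add: segment_ideal_def zero_with_infty_def max_neg_nonneg)
  with x show ?thesis by (auto simp: val_supp_def)
qed

lemma segment_ideal_ideal_segment:
  assumes I: "v_convex R v I"
  shows "segment_ideal (ideal_segment I) = I"
proof
  show "I \<subseteq> segment_ideal (ideal_segment I)"
  proof
    fix x assume x: "x \<in> I"
    have "Fin h < v x" if "h \<in> ideal_segment I" for h
    proof -
      have "Fin h \<le> Fin (max h (- h))" by simp
      also have "\<dots> < v x" using that x by (simp add: ideal_segment_def)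
      finally show ?thesis .
    qed
    then show "x \<in> segment_ideal (ideal_segment I)"
      using v_convex_in_val_ring[OF I x] by (simp add: segment_ideal_def)
  qed
  show "segment_ideal (ideal_segment I) \<subseteq> I"
  proof
    fix x assume "x \<in> segment_ideal (ideal_segment I)"
    then have x: "x \<in> carrier R" "0 \<le> v x" "\<And>h. h \<in> ideal_segment I \<Longrightarrow> Fin h < v x"
      by (auto simp: segment_ideal_def)
    show "x \<in> I"
    proof (cases "v x")
      case (Fin a)
      with x have "a \<notin> ideal_segment I" by force
      then show ?thesis
        using mem_ideal_segment_iff[OF I x(1) Fin] x(2) by (simp add: Fin zero_with_infty_def)
    next
      case Infty
      then show ?thesis using x supp_subset_v_convex[OF I] by (auto simp: val_supp_def)
    qed
  qed
qed

lemma ideal_segment_segment_ideal: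
  assumes H: "segment H"
  shows "ideal_segment (segment_ideal H) = H"
proof
  show "H \<subseteq> ideal_segment (segment_ideal H)"
  proof
    fix g assume "g \<in> H"
    then have "max g (- g) \<in> H"
      by (rule segmentD[OF H]) (simp add: max_neg_of_nonneg[OF max_neg_nonneg])
    then show "g \<in> ideal_segment (segment_ideal H)"
      by (auto simp: ideal_segment_def segment_ideal_def)
  qed
  show "ideal_segment (segment_ideal H) \<subseteq> H"
  proof
    fix g assume "g \<in> ideal_segment (segment_ideal H)"
    then have g: "max g (- g) \<in> ideal_segment (segment_ideal H)"
      by (simp only: ideal_segment_max_neg)
    obtain x where x: "x \<in> carrier R" "v x = Fin (max g (- g))" by (rule val_onto)
    with g have "x \<notin> segment_ideal H"
      using mem_ideal_segment_iff[OF v_convex_segment_ideal x] max_neg_nonneg by blast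
    then obtain h where h: "h \<in> H" "\<not> h < max g (- g)"
      using x by (auto simp: segment_ideal_def zero_with_infty_def max_neg_nonneg)
    then have "max g (- g) \<le> max h (- h)" by (meson max.coboundedI1 not_le)
    with h H show "g \<in> H" by (metis segmentD)
  qed
qed

lemma segments_correspondence:
  "order_reversing_bij ideal_segment
     {I. v_convex R v I \<and> \<not> I \<subseteq> val_supp R v} {H. proper_segment H}"
proof (rule order_reversing_bijI)
  show "antimono ideal_segment" and "antimono segment_ideal"
    by (rule antimono_ideal_segment antimono_segment_ideal)+
qed (simp_all add: proper_ideal_segment v_convex_segment_ideal segment_ideal_not_subset_supp
    segment_ideal_ideal_segment ideal_segment_segment_ideal proper_segment_imp_segment)

end


section \<open>Valuations on superrings\<close>

locale valued_superring = superring R R0 R1 + valuation R v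
  for R (structure) and R0 R1 :: "'a set"
    and v :: "'a \<Rightarrow> 'g::linordered_ab_group_add with_infty"
begin

lemma even_carrier: "x \<in> R0 \<Longrightarrow> x \<in> carrier R"
  by (rule additive_subgroup.a_Hcarr[OF even_subgroup])

lemma odd_carrier: "x \<in> R1 \<Longrightarrow> x \<in> carrier R"
  by (rule additive_subgroup.a_Hcarr[OF odd_subgroup])

lemma val_odd: "x \<in> R1 \<Longrightarrow> v x = Infty"
  using with_infty_add_eq_Infty_iff[of "v x" "v x"] val_mult[of x x] odd_square_zero[of x]
    odd_carrier[of x] val_zero by metis

lemma even_odd_decomposition:
  assumes "x \<in> carrier R"
  obtains x0 x1 where "x0 \<in> R0" and "x1 \<in> R1" and "x = x0 \<oplus> x1"
  using assms even_plus_odd unfolding set_add_def' by blast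

text \<open>The even part is obtained by subtracting an element of infinite value.\<close>

lemma val_even_part:
  assumes "x0 \<in> R0" and "x1 \<in> R1"
  shows "v (x0 \<oplus> x1) \<le> v x0"
proof -
  have c: "x0 \<in> carrier R" "x1 \<in> carrier R" using assms even_carrier odd_carrier by auto
  then have "x0 = (x0 \<oplus> x1) \<ominus> x1" by algebra
  then have "min (v (x0 \<oplus> x1)) (v x1) \<le> v x0" using val_diff[of "x0 \<oplus> x1" x1] c by simp
  then show ?thesis using val_odd[OF assms(2)] by (simp add: min_def)
qed

text \<open>The odd part \<open>x\<^sub>1\<close> does not commute with \<open>y\<^sub>1\<close> in general, but all other terms of the
  commutator cancel, and products involving an odd element have infinite value.\<close>

lemma val_commutator:
  assumes "x \<in> carrier R" and "y \<in> carrier R"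
  shows "v (x \<otimes> y \<ominus> y \<otimes> x) = Infty"
proof -
  obtain x0 x1 where x: "x0 \<in> R0" "x1 \<in> R1" "x = x0 \<oplus> x1"
    using assms(1) by (rule even_odd_decomposition)
  obtain y0 y1 where y: "y0 \<in> R0" "y1 \<in> R1" "y = y0 \<oplus> y1"
    using assms(2) by (rule even_odd_decomposition)
  note c = even_carrier[OF x(1)] even_carrier[OF y(1)] odd_carrier[OF x(2)] odd_carrier[OF y(2)]
  have comm: "x0 \<otimes> y0 = y0 \<otimes> x0" "x0 \<otimes> y1 = y1 \<otimes> x0" "x1 \<otimes> y0 = y0 \<otimes> x1"
    using even_central x y c by auto
  have "x \<otimes> y \<ominus> y \<otimes> x = (x0 \<otimes> y0 \<oplus> x0 \<otimes> y1 \<oplus> x1 \<otimes> y0 \<oplus> x1 \<otimes> y1)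
      \<ominus> (y0 \<otimes> x0 \<oplus> y1 \<otimes> x0 \<oplus> y0 \<otimes> x1 \<oplus> y1 \<otimes> x1)"
    unfolding x(3) y(3) using c by algebra
  also have "\<dots> = x1 \<otimes> y1 \<ominus> y1 \<otimes> x1"
    unfolding comm using c by algebra
  finally have "x \<otimes> y \<ominus> y \<otimes> x = x1 \<otimes> y1 \<ominus> y1 \<otimes> x1" .
  moreover have "v (x1 \<otimes> y1 \<ominus> y1 \<otimes> x1) = Infty"
    using val_diff[of "x1 \<otimes> y1" "y1 \<otimes> x1"] c by (simp add: val_mult val_odd x y)
  ultimately show ?thesis by simp
qed

text \<open>Convexity puts both homogeneous parts of an element into the ideal: neither has a smaller value
  than the element itself.\<close>

lemma v_convex_superideal:
  assumes I: "v_convex R v I"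
  shows "val_superideal R R0 R1 v I"
proof -
  have ideal: "ideal I (val_ring R v)" using I by (simp add: v_convex_def)
  let ?A = "carrier (val_ring R v)"
  have "(I \<inter> (?A \<inter> R0)) <+>\<^bsub>val_ring R v\<^esub> (I \<inter> (?A \<inter> R1)) = I" (is "?S = I")
  proof
    show "?S \<subseteq> I"
      using additive_subgroup.a_closed[OF ideal.axioms(1)[OF ideal]]
      unfolding set_add_def' by auto
    show "I \<subseteq> ?S"
    proof
      fix x assume x: "x \<in> I"
      then obtain x0 x1 where d: "x0 \<in> R0" "x1 \<in> R1" "x = x0 \<oplus> x1"
        using even_odd_decomposition v_convex_in_val_ring[OF I] by metis
      have "x0 \<in> I"
        using v_convexD[OF I x even_carrier[OF d(1)]] val_even_part[OF d(1,2)] d by simp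
      moreover have "x1 \<in> I"
        using v_convexD[OF I x odd_carrier[OF d(2)]] val_odd[OF d(2)] by simp
      ultimately show "x \<in> ?S"
        using d v_convex_in_val_ring[OF I] unfolding set_add_def' by auto
    qed
  qed
  with ideal show ?thesis by (simp add: val_superideal_def superideal_def)
qed


section \<open>Convex prime ideals\<close>

lemma prime_ideal_val_ring_iff:
  assumes I: "ideal I (val_ring R v)" and supp: "val_supp R v \<subseteq> I"
  shows "prime_ideal I (val_ring R v) \<longleftrightarrow> \<one> \<notin> I \<and>
    (\<forall>x y. x \<in> carrier R \<longrightarrow> y \<in> carrier R \<longrightarrow> 0 \<le> v x \<longrightarrow> 0 \<le> v y \<longrightarrow> x \<otimes> y \<in> I \<longrightarrow>
       x \<in> I \<or> y \<in> I)"
proof -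
  interpret A: ring "val_ring R v" by (rule ring_val_ring)
  have "x \<otimes> y \<ominus>\<^bsub>val_ring R v\<^esub> y \<otimes> x \<in> I"
    if "x \<in> carrier (val_ring R v)" "y \<in> carrier (val_ring R v)" for x y
  proof -
    have c: "x \<in> carrier R" "y \<in> carrier R" using that by auto
    have "y \<otimes> x \<in> carrier (val_ring R v)" using A.m_closed[OF that(2,1)] by simp
    then have "x \<otimes> y \<ominus>\<^bsub>val_ring R v\<^esub> y \<otimes> x = x \<otimes> y \<ominus> y \<otimes> x"
      by (simp add: a_minus_def minus_val_ring)
    moreover have "x \<otimes> y \<ominus> y \<otimes> x \<in> val_supp R v"
      using c val_commutator by (simp add: val_supp_def)
    ultimately show ?thesis using supp by auto
  qed
  then show ?thesis unfolding ideal.prime_ideal_iff[OF I] by auto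
qed

text \<open>Both conditions concern sums of non-negative group elements outside the set of values of the
  ideal. For arbitrary \<open>g\<close> and \<open>h\<close> in the segment, additive closure is reduced to this case by the
  triangle inequality \<open>\<bar>g + h\<bar> \<le> \<bar>g\<bar> + \<bar>h\<bar>\<close>.\<close>

lemma prime_iff_isolated:
  assumes I: "v_convex R v I" and nsupp: "\<not> I \<subseteq> val_supp R v"
  shows "prime_ideal I (val_ring R v) \<longleftrightarrow> isolated_subgroup (ideal_segment I)"
proof -
  have "ideal I (val_ring R v)" using I by (simp add: v_convex_def)
  note prime = prime_ideal_val_ring_iff[OF this supp_subset_v_convex[OF I]]
  note mem = mem_ideal_segment_iff[OF I]
  have zero: "0 \<in> ideal_segment I \<longleftrightarrow> \<one> \<notin> I"
    using mem[of \<one> 0] by (simp add: val_one zero_with_infty_def)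
  show ?thesis
  proof
    assume P: "prime_ideal I (val_ring R v)"
    show "isolated_subgroup (ideal_segment I)"
      unfolding isolated_subgroup_def
    proof (intro conjI ballI)
      show "0 \<in> ideal_segment I" using P zero prime by blast
      show "ideal_segment I \<noteq> UNIV" and "segment (ideal_segment I)"
        using proper_ideal_segment[OF I nsupp] by (auto simp: proper_segment_def)
      show "- g \<in> ideal_segment I" if "g \<in> ideal_segment I" for g
        using that by (simp add: ideal_segment_def max.commute)
    next
      fix g h assume "g \<in> ideal_segment I" "h \<in> ideal_segment I"
      then have gh: "max g (- g) \<in> ideal_segment I" "max h (- h) \<in> ideal_segment I"
        by (simp_all only: ideal_segment_max_neg)
      obtain x where x: "x \<in> carrier R" "v x = Fin (max g (- g))" by (rule val_onto)
      obtain y where y: "y \<in> carrier R" "v y = Fin (max h (- h))" by (rule val_onto)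
      have "x \<notin> I" "y \<notin> I"
        using gh mem[OF x max_neg_nonneg] mem[OF y max_neg_nonneg] by auto
      moreover have "0 \<le> v x" "0 \<le> v y"
        using x y by (simp_all add: zero_with_infty_def max_neg_nonneg)
      ultimately have "x \<otimes> y \<notin> I" using P prime x y by blast
      moreover have "v (x \<otimes> y) = Fin (max g (- g) + max h (- h))"
        using x y by (simp add: val_mult)
      moreover have nonneg: "0 \<le> max g (- g) + max h (- h)"
        by (rule add_nonneg_nonneg[OF max_neg_nonneg max_neg_nonneg])
      ultimately have "max g (- g) + max h (- h) \<in> ideal_segment I"
        using mem[of "x \<otimes> y"] x y by simp
      then show "g + h \<in> ideal_segment I"
        by (rule segmentD[OF segment_ideal_segment])
          (unfold max_neg_of_nonneg[OF nonneg], rule max_neg_triangle)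
    qed
  next
    assume H: "isolated_subgroup (ideal_segment I)"
    show "prime_ideal I (val_ring R v)"
      unfolding prime
    proof (intro conjI allI impI)
      show "\<one> \<notin> I" using H zero by (simp add: isolated_subgroup_def)
      fix x y assume x: "x \<in> carrier R" "0 \<le> v x" and y: "y \<in> carrier R" "0 \<le> v y"
        and xy: "x \<otimes> y \<in> I"
      show "x \<in> I \<or> y \<in> I"
      proof (rule ccontr)
        assume "\<not> (x \<in> I \<or> y \<in> I)"
        then have n: "x \<notin> I" "y \<notin> I" by auto
        then have "v x \<noteq> Infty" "v y \<noteq> Infty"
          using supp_subset_v_convex[OF I] x y by (auto simp: val_supp_def)
        then obtain a b where a: "v x = Fin a" and b: "v y = Fin b"
          by (metis with_infty.exhaust)
        have ab: "0 \<le> a" "0 \<le> b" using x y by (simp_all add: a b zero_with_infty_def)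
        have "a \<in> ideal_segment I" "b \<in> ideal_segment I"
          using mem[OF x(1) a ab(1)] mem[OF y(1) b ab(2)] n by auto
        then have "a + b \<in> ideal_segment I" using H by (simp add: isolated_subgroup_def)
        moreover have "v (x \<otimes> y) = Fin (a + b)" using x y a b by (simp add: val_mult)
        ultimately show False using mem[of "x \<otimes> y" "a + b"] x y xy ab by simp
      qed
    qed
  qed
qed

lemma v_convex_prime_subset_val_ideal:
  assumes I: "v_convex R v I" and P: "prime_ideal I (val_ring R v)"
  shows "I \<subseteq> val_ideal R v"
proof
  fix x assume x: "x \<in> I"
  have "ideal I (val_ring R v)" using I by (simp add: v_convex_def)
  then have "\<one> \<notin> I" using P prime_ideal_val_ring_iff supp_subset_v_convex[OF I] by blast
  then have "\<not> v x \<le> 0" using v_convexD[OF I x one_closed] val_one by auto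
  then show "x \<in> val_ideal R v"
    using v_convex_in_val_ring[OF I x] by (simp add: val_ideal_def)
qed

text \<open>Division by \<open>x\<close>, of value \<open>a\<close>, is replaced by multiplication with an element \<open>z\<close> of value \<open>- a\<close>. It
  need not lie in the valuation ring, but \<open>z x\<close> and \<open>z y\<close> do.\<close>

lemma convex_if_between:
  assumes P: "prime_ideal I (val_ring R v)"
    and supp: "val_supp R v \<subseteq> I" and sub: "I \<subseteq> val_ideal R v"
  shows "v_convex R v I"
proof -
  have I: "ideal I (val_ring R v)" using P by (simp add: prime_ideal_def)
  interpret I: ideal I "val_ring R v" by (rule I)
  note prime = P[unfolded prime_ideal_val_ring_iff[OF I supp]]
  have "y \<in> I" if x: "x \<in> I" and y: "y \<in> carrier R" and le: "v x \<le> v y" for x y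
  proof (cases "v x")
    case Infty
    with y le supp show ?thesis by (auto simp: val_supp_def)
  next
    case (Fin a)
    have xc: "x \<in> carrier R" "0 \<le> v x" using I.Icarr[OF x] by auto
    have y0: "0 \<le> v y" using xc(2) le by (rule order_trans)
    obtain z where z: "z \<in> carrier R" "v z = Fin (- a)" by (rule val_onto)
    have zx: "v (z \<otimes> x) = 0" using z xc Fin by (simp add: val_mult zero_with_infty_def)
    have zy: "0 \<le> v (z \<otimes> y)"
      using z y le Fin by (cases "v y") (auto simp: val_mult zero_with_infty_def)
    have "(z \<otimes> y) \<otimes> x \<in> I" using I.I_l_closed[OF x, of "z \<otimes> y"] z y zy by simp
    \<comment> \<open>Exchanging \<open>x\<close> and \<open>y\<close> costs a commutator, which lies in the support even after
      multiplication by \<open>z\<close>.\<close>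
    moreover have "(z \<otimes> x) \<otimes> y = z \<otimes> (x \<otimes> y \<ominus> y \<otimes> x) \<oplus> (z \<otimes> y) \<otimes> x"
      using z xc y by algebra
    moreover have "z \<otimes> (x \<otimes> y \<ominus> y \<otimes> x) \<in> I"
      using supp z xc y val_commutator by (auto simp: val_supp_def val_mult)
    ultimately have "(z \<otimes> x) \<otimes> y \<in> I"
      using additive_subgroup.a_closed[OF ideal.axioms(1)[OF I]] by simp
    moreover have "z \<otimes> x \<notin> I" using sub zx by (auto simp: val_ideal_def)
    ultimately show ?thesis using prime z xc y y0 zx by (metis m_closed order_refl)
  qed
  with I show ?thesis by (simp add: v_convex_def)
qed

end

theorem proposition2p22:
  fixes R :: "('a, 'm) ring_scheme" and R0 R1 :: "'a set"
    and v :: "'a \<Rightarrow> 'g::linordered_ab_group_add with_infty"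
  assumes "superring R R0 R1" and "valuation R v"
  shows
    "(\<exists>f. order_reversing_bij f
        {I. val_superideal R R0 R1 v I \<and> v_convex R v I \<and> \<not> I \<subseteq> val_supp R v}
        {H :: 'g set. proper_segment H}) \<and>
     (\<exists>f. order_reversing_bij f
        {I. val_superideal R R0 R1 v I \<and> v_convex R v I \<and> prime_ideal I (val_ring R v) \<and>
            \<not> I \<subseteq> val_supp R v}
        {H :: 'g set. isolated_subgroup H}) \<and>
     {I. v_convex R v I \<and> prime_ideal I (val_ring R v)} =
       {I. prime_ideal I (val_ring R v) \<and> val_supp R v \<subseteq> I \<and> I \<subseteq> val_ideal R v}"
proof -
  interpret superring R R0 R1 by fact
  interpret valuation R v by fact
  interpret valued_superring R R0 R1 v ..
  have convex: "{I. val_superideal R R0 R1 v I \<and> v_convex R v I \<and> \<not> I \<subseteq> val_supp R v} =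
      {I. v_convex R v I \<and> \<not> I \<subseteq> val_supp R v}"
    using v_convex_superideal by blast
  have convex_prime: "order_reversing_bij ideal_segment
      {I. val_superideal R R0 R1 v I \<and> v_convex R v I \<and> prime_ideal I (val_ring R v) \<and>
          \<not> I \<subseteq> val_supp R v} {H. isolated_subgroup H}"
    by (rule order_reversing_bij_restrict[OF segments_correspondence])
      (auto simp: v_convex_superideal prime_iff_isolated isolated_subgroup_def proper_segment_def)
  have "{I. v_convex R v I \<and> prime_ideal I (val_ring R v)} =
      {I. prime_ideal I (val_ring R v) \<and> val_supp R v \<subseteq> I \<and> I \<subseteq> val_ideal R v}"
    using supp_subset_v_convex v_convex_prime_subset_val_ideal convex_if_between by blast
  with segments_correspondence convex_prime show ?thesis unfolding convex by blast
qed

end
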